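(* Let $L_x\in\mathbb{R}^{N_x\times N_x}$ and $L_y\in\mathbb{R}^{N_y\times N_y}$ each be irreducible with zero column sums, spectral abscissa $0$ with $0$ a simple eigenvalue, and eventually exponentially positive. Let $A_{xy}\in\mathbb{R}^{N_xN_y\times N_xN_y}$ have zero column sums and real non-positive spectrum. Let $A_x=L_x\otimes I_{N_y}$, $A_y=I_{N_x}\otimes L_y$, and for $s,\Delta t>0$ let $$\Phi_\alpha(s)=\Bigl(\mathcal I-sA_\alpha+\tfrac{s^2}{2}A_\alpha^2\Bigr)^{-1}\ (\alpha\in\{x,y\}),\qquad \Phi_{xy}(\Delta t)=\Bigl(\mathcal I-\tfrac{\Delta t}{2}A_{xy}\Bigr)^{-1}\Bigl(\mathcal I+\tfrac{\Delta t}{2}A_{xy}\Bigr),$$ $$\mathcal S_{\mathrm{ADI}}(\Delta t)=\Phi_x(\tfrac{\Delta t}{2})\,\Phi_y(\tfrac{\Delta t}{2})\,\Phi_{xy}(\Delta t)\,\Phi_y(\tfrac{\Delta t}{2})\,\Phi_x(\tfrac{\Delta t}{2}).$$ For $\alpha\in\{x,y\}$ let $\gamma_r^{(\alpha)}\ge 0$ be a Padé threshold of $L_\alpha$, and let $\Theta>0$ be a window of the central factor. Suppose $\Delta t>0$ satisfies (i) $\tfrac{\Delta t}{2}\ge\gamma_r^{(\alpha)}$ for $\alpha\in\{x,y\}$, and (ii) $\Delta t\le\Theta$, that is, $\Delta t\in[2\gamma_r,\Theta]$ with $\gamma_r=\max_\alpha\gamma_r^{(\alpha)}$. Then each of the five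 factors of $\mathcal S_{\mathrm{ADI}}(\Delta t)$ is entrywise nonnegative; $\mathcal S_{\mathrm{ADI}}(\Delta t)$ is entrywise nonnegative with unit column sums, i.e. column-stochastic; and the scheme $\boldsymbol p^{\,n+1}=\mathcal S_{\mathrm{ADI}}(\Delta t)\boldsymbol p^{\,n}$ is positive ($\boldsymbol p\ge0$ implies $\mathcal S_{\mathrm{ADI}}(\Delta t)\boldsymbol p\ge0$) and $\ell_1$-nonexpansive on the nonnegative cone ($\|\mathcal S_{\mathrm{ADI}}(\Delta t)\boldsymbol p\|_1\le\|\boldsymbol p\|_1$ for all $\boldsymbol p\ge0$).
   Context: Inequalities between matrices or vectors are entrywise. $\mathcal I$ is the identity of size $N_xN_y$, $I_m$ the $m\times m$ identity, $\otimes$ the Kronecker product. A matrix $L$ is eventually exponentially positive if there is $\tau_0\ge0$ with $e^{tL}>0$ for all $t\ge\tau_0$; the spectral abscissa is the maximal real part of the eigenvalues. A Padé threshold of $L_\alpha$ is a number $\gamma_r^{(\alpha)}\in[0,\infty)$ such that $(I-\gamma L_\alpha+\tfrac{\gamma^2}{2}L_\alpha^2)^{-1}>0$ for all $\gamma>0$ with $\gamma\ge\gamma_r^{(\alpha)}$ (such a number exists under the stated hypotheses on $L_\alpha$). A window of the central factor is a number $\Theta>0$ such that $\Phi_{xy}(\tau)\ge0$ for all $\tau\in(0,\Theta]$. *)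

theory Defs
  imports "HOL-Analysis.Analysis"
begin

text \<open>
  A matrix with $m$ rows and $n$ columns is \<^typ>\<open>real ^ 'n ^ 'm\<close>, acting on column
  vectors by \<open>*v\<close>.  The library order on vectors is componentwise, so \<open>0 \<le> A\<close> and \<open>0 \<le> p\<close>
  are the entrywise inequalities.  The library's strict \<open>0 < A\<close> only says \<open>0 \<le> A \<and> A \<noteq> 0\<close>,
  hence the separate predicate for strict entrywise positivity.
\<close>

definition entrywise_pos :: "real ^ 'n ^ 'm \<Rightarrow> bool" where
  "entrywise_pos A \<longleftrightarrow> (\<forall>i j. 0 < A $ i $ j)"

definition col_sum :: "real ^ 'n ^ 'm \<Rightarrow> 'n \<Rightarrow> real" where
  "col_sum A j = (\<Sum>i\<in>UNIV. A $ i $ j)"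

definition column_stochastic :: "real ^ 'n ^ 'n \<Rightarrow> bool" where
  "column_stochastic A \<longleftrightarrow> 0 \<le> A \<and> (\<forall>j. col_sum A j = 1)"

definition l1_norm :: "real ^ 'n \<Rightarrow> real" where
  "l1_norm p = (\<Sum>i\<in>UNIV. \<bar>p $ i\<bar>)"

text \<open>
  A matrix is reducible if a simultaneous permutation of rows and columns makes it block
  triangular with two nonempty square diagonal blocks.  The index type carries no order, so the
  permutation amounts to the choice of the set \<open>S\<close> of indices of one diagonal block.
  Every $1 \times 1$ matrix is irreducible.
\<close>

definition irreducible_mat :: "real ^ 'n ^ 'n \<Rightarrow> bool" where
  "irreducible_mat A \<longleftrightarrow>
     \<not> (\<exists>S. S \<noteq> {} \<and> S \<noteq> UNIV \<and> (\<forall>i\<in>S. \<forall>j\<in>-S. A $ i $ j = 0))"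

text \<open>Eigenvalues of a real matrix are complex numbers throughout.\<close>

definition complex_mat :: "real ^ 'n ^ 'm \<Rightarrow> complex ^ 'n ^ 'm" where
  "complex_mat A = map_matrix complex_of_real A"

definition eigenvalues :: "real ^ 'n ^ 'n \<Rightarrow> complex set" where
  "eigenvalues A = {z. \<exists>v. v \<noteq> 0 \<and> complex_mat A *v v = z *s v}"

definition spectral_abscissa :: "real ^ 'n ^ 'n \<Rightarrow> real" where
  "spectral_abscissa A = Max (Re ` eigenvalues A)"

definition charpoly :: "'a::comm_ring_1 ^ 'n ^ 'n \<Rightarrow> 'a poly" where
  "charpoly A = det (mat [:0, 1:] - map_matrix (\<lambda>a. [:a:]) A)"

text \<open>Simple means of algebraic multiplicity one.\<close>

definition simple_eigenvalue :: "real ^ 'n ^ 'n \<Rightarrow> complex \<Rightarrow> bool" where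
  "simple_eigenvalue A z \<longleftrightarrow> z \<in> eigenvalues A \<and> order z (charpoly (complex_mat A)) = 1"

text \<open>
  \<open>exp\<close>, \<open>*\<close> and \<open>^\<close> on the library's matrix type are not the matrix operations (\<open>*\<close> is
  componentwise), so powers and the exponential series are built from \<open>**\<close>.
\<close>

definition mat_pow :: "real ^ 'n ^ 'n \<Rightarrow> nat \<Rightarrow> real ^ 'n ^ 'n" where
  "mat_pow A k = (((**) A) ^^ k) (mat 1)"

definition mat_exp :: "real ^ 'n ^ 'n \<Rightarrow> real ^ 'n ^ 'n" where
  "mat_exp A = (\<Sum>k. (1 / fact k) *\<^sub>R mat_pow A k)"

definition eventually_exp_pos :: "real ^ 'n ^ 'n \<Rightarrow> bool" where
  "eventually_exp_pos L \<longleftrightarrow> (\<exists>\<tau>0\<ge>0. \<forall>t\<ge>\<tau>0. entrywise_pos (mat_exp (t *\<^sub>R L)))"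

text \<open>The index pair \<open>(i, k)\<close> stands for row \<open>i\<close> of \<open>A\<close> and row \<open>k\<close> of \<open>B\<close>.\<close>

definition kronecker ::
  "real ^ 'n ^ 'm \<Rightarrow> real ^ 'q ^ 'p \<Rightarrow> real ^ ('n::finite \<times> 'q::finite) ^ ('m::finite \<times> 'p::finite)" (infixl "\<otimes>\<^sub>K" 75) where
  "A \<otimes>\<^sub>K B = (\<chi> r c. A $ fst r $ fst c * B $ snd r $ snd c)"

text \<open>
  In the two factors below \<open>matrix_inv\<close> is applied to invertible matrices only: the first one is
  singular only if \<open>A\<close> has an eigenvalue \<open>(1 \<plusminus> \<i>) / s\<close>, the second one only if \<open>A\<close> has the
  eigenvalue \<open>2 / s\<close>, and for \<open>s > 0\<close> these lie in the open right half plane.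
\<close>

definition pade_factor :: "real ^ 'n ^ 'n \<Rightarrow> real \<Rightarrow> real ^ 'n ^ 'n" where
  "pade_factor A s = matrix_inv (mat 1 - s *\<^sub>R A + (s\<^sup>2 / 2) *\<^sub>R (A ** A))"

definition central_factor :: "real ^ 'n ^ 'n \<Rightarrow> real \<Rightarrow> real ^ 'n ^ 'n" where
  "central_factor A s = matrix_inv (mat 1 - (s / 2) *\<^sub>R A) ** (mat 1 + (s / 2) *\<^sub>R A)"

definition pade_threshold :: "real ^ 'n ^ 'n \<Rightarrow> real \<Rightarrow> bool" where
  "pade_threshold L \<gamma>r \<longleftrightarrow> 0 \<le> \<gamma>r \<and> (\<forall>\<gamma>>0. \<gamma> \<ge> \<gamma>r \<longrightarrow> entrywise_pos (pade_factor L \<gamma>))"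

definition central_window :: "real ^ 'n ^ 'n \<Rightarrow> real \<Rightarrow> bool" where
  "central_window A \<Theta> \<longleftrightarrow> 0 < \<Theta> \<and> (\<forall>\<tau>\<in>{0<..\<Theta>}. 0 \<le> central_factor A \<tau>)"

definition A_x :: "real ^ 'nx ^ 'nx \<Rightarrow> real ^ ('nx::finite \<times> 'ny::finite) ^ ('nx::finite \<times> 'ny::finite)" where
  "A_x Lx = Lx \<otimes>\<^sub>K mat 1"

definition A_y :: "real ^ 'ny ^ 'ny \<Rightarrow> real ^ ('nx::finite \<times> 'ny::finite) ^ ('nx::finite \<times> 'ny::finite)" where
  "A_y Ly = mat 1 \<otimes>\<^sub>K Ly"

definition S_ADI ::
  "real ^ 'nx ^ 'nx \<Rightarrow> real ^ 'ny ^ 'ny \<Rightarrow> real ^ ('nx::finite \<times> 'ny::finite) ^ ('nx::finite \<times> 'ny::finite) \<Rightarrow> real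
    \<Rightarrow> real ^ ('nx::finite \<times> 'ny::finite) ^ ('nx::finite \<times> 'ny::finite)" where
  "S_ADI Lx Ly Axy dt =
     pade_factor (A_x Lx) (dt / 2) ** pade_factor (A_y Ly) (dt / 2) ** central_factor Axy dt
       ** pade_factor (A_y Ly) (dt / 2) ** pade_factor (A_x Lx) (dt / 2)"

end

theory Submission
  imports Defs
begin

text \<open>
  Each factor is the inverse of a matrix with unit column sums, multiplied in the central case by
  another such matrix; the spectral hypotheses exclude the poles of the rational functions and so
  make the inverses genuine. Unit column sums survive multiplication and inversion, and
  nonnegativity survives multiplication, so \<open>S_ADI\<close> is column-stochastic. The Pade
  factor of \<open>Lx \<otimes>\<^sub>K mat 1\<close> is the Pade factor of \<open>Lx\<close> tensored with
  \<open>mat 1\<close>, and therefore inherits its nonnegativity.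
\<close>

section \<open>Column sums and matrix inverses\<close>

lemma col_sum_matrix_mult:
  "col_sum (A ** B) j = (\<Sum>k\<in>UNIV. col_sum A k * B $ k $ j)"
proof -
  have "col_sum (A ** B) j = (\<Sum>i\<in>UNIV. \<Sum>k\<in>UNIV. A $ i $ k * B $ k $ j)"
    by (simp add: col_sum_def matrix_matrix_mult_def)
  also have "\<dots> = (\<Sum>k\<in>UNIV. \<Sum>i\<in>UNIV. A $ i $ k * B $ k $ j)"
    by (rule sum.swap)
  finally show ?thesis by (simp add: col_sum_def sum_distrib_right)
qed

lemma col_sum_mat_1: "col_sum (mat 1) j = 1"
  by (simp add: col_sum_def mat_def)

lemma col_sum_add: "col_sum (A + B) j = col_sum A j + col_sum B j"
  by (simp add: col_sum_def sum.distrib)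

lemma col_sum_diff: "col_sum (A - B) j = col_sum A j - col_sum B j"
  by (simp add: col_sum_def sum_subtractf)

lemma col_sum_scaleR: "col_sum (c *\<^sub>R A) j = c * col_sum A j"
  by (simp add: col_sum_def sum_distrib_left)

lemma col_sum_matrix_mult_unit:
  assumes "\<forall>j. col_sum A j = 1" and "\<forall>j. col_sum B j = 1"
  shows "\<forall>j. col_sum (A ** B) j = 1"
  using assms by (simp add: col_sum_matrix_mult) (simp add: col_sum_def)

text \<open>For square matrices over a field a right inverse is two-sided, so the choice behind
  \<open>matrix_inv\<close> has a witness, and two-sided inverses coincide.\<close>

lemma matrix_inv_unique:
  fixes A B :: "'a::field ^ 'n ^ 'n"
  assumes "A ** B = mat 1"
  shows "matrix_inv A = B"
proof -
  have BA: "B ** A = mat 1" by (rule iffD1[OF matrix_left_right_inverse assms])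
  have "A ** matrix_inv A = mat 1 \<and> matrix_inv A ** A = mat 1"
    unfolding matrix_inv_def
    by (rule someI[where P = "\<lambda>B. A ** B = mat 1 \<and> B ** A = mat 1" and x = B])
      (simp add: assms BA)
  then show ?thesis
    by (metis BA matrix_mul_assoc matrix_mul_lid matrix_mul_rid)
qed

text \<open>An injective square matrix has a left inverse, which is also a right inverse;
  invertibility of the denominators thus reduces to kernel computations.\<close>

lemma matrix_inv_right_of_trivial_kernel:
  fixes A :: "'a::field ^ 'n ^ 'n"
  assumes "\<And>v. A *v v = 0 \<Longrightarrow> v = 0"
  shows "A ** matrix_inv A = mat 1"
proof -
  have "\<exists>B. B ** A = mat 1"
    unfolding matrix_left_invertible_ker using assms by simp
  then obtain B where "B ** A = mat 1" by (rule exE)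
  then have "A ** B = mat 1" by (rule iffD2[OF matrix_left_right_inverse])
  then show ?thesis using matrix_inv_unique by metis
qed

text \<open>Unit column sums mean that the row vector of ones is fixed under right multiplication by
  \<open>A\<close>; multiplying this identity by \<open>B\<close> on the right gives the same for
  \<open>B\<close>.\<close>

lemma col_sum_right_inverse:
  fixes A B :: "real ^ 'n ^ 'n"
  assumes "\<forall>j. col_sum A j = 1" and "A ** B = mat 1"
  shows "\<forall>j. col_sum B j = 1"
proof
  fix j
  have "col_sum B j = col_sum (A ** B) j"
    by (simp add: col_sum_matrix_mult assms(1)) (simp add: col_sum_def)
  then show "col_sum B j = 1" by (simp add: assms(2) col_sum_mat_1)
qed

section \<open>Nonnegativity and the l1 norm\<close>

lemma nonneg_matrix_iff: "0 \<le> (A :: real ^ 'n ^ 'm) \<longleftrightarrow> (\<forall>i j. 0 \<le> A $ i $ j)"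
  by (simp add: less_eq_vec_def)

lemma nonneg_matrix_mult:
  fixes A :: "real ^ 'n ^ 'm" and B :: "real ^ 'k ^ 'n"
  assumes "0 \<le> A" and "0 \<le> B"
  shows "0 \<le> A ** B"
  using assms by (auto simp: nonneg_matrix_iff matrix_matrix_mult_def intro!: sum_nonneg)

lemma nonneg_matrix_vector_mult:
  fixes A :: "real ^ 'n ^ 'm"
  assumes "0 \<le> A" and "0 \<le> p"
  shows "0 \<le> A *v p"
  using assms by (auto simp: less_eq_vec_def matrix_vector_mult_def intro!: sum_nonneg)

text \<open>On the nonnegative cone the norm is the plain sum of the entries, which unit column sums
  conserve. Nonexpansiveness therefore holds with equality.\<close>

lemma column_stochastic_l1_norm:
  assumes "column_stochastic A" and "0 \<le> p"
  shows "l1_norm (A *v p) = l1_norm p"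
proof -
  have l1: "l1_norm q = (\<Sum>i\<in>UNIV. q $ i)" if "0 \<le> q" for q :: "real ^ 'a"
    using that by (simp add: l1_norm_def less_eq_vec_def)
  have "0 \<le> A *v p"
    using assms by (auto simp: column_stochastic_def intro: nonneg_matrix_vector_mult)
  then have "l1_norm (A *v p) = (\<Sum>i\<in>UNIV. \<Sum>k\<in>UNIV. A $ i $ k * p $ k)"
    by (simp add: l1 matrix_vector_mult_def)
  also have "\<dots> = (\<Sum>k\<in>UNIV. \<Sum>i\<in>UNIV. A $ i $ k * p $ k)"
    by (rule sum.swap)
  also have "\<dots> = (\<Sum>k\<in>UNIV. col_sum A k * p $ k)"
    by (simp add: col_sum_def sum_distrib_right)
  also have "\<dots> = l1_norm p"
    using assms by (simp add: column_stochastic_def l1)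
  finally show ?thesis .
qed

section \<open>Eigenvalues and the spectral abscissa\<close>

lemma poly_charpoly: "poly (charpoly A) z = det (mat z - A)"
  unfolding charpoly_def det_def
  by (simp add: poly_sum poly_prod mat_def if_distrib if_distribR cong: if_cong)

text \<open>A nontrivial kernel of \<open>mat z - complex_mat A\<close> amounts to a vanishing
  determinant. Finiteness of the spectrum is thereby reduced to that of the roots of a nonzero
  polynomial.\<close>

lemma eigenvalue_iff_charpoly_root:
  "z \<in> eigenvalues A \<longleftrightarrow> poly (charpoly (complex_mat A)) z = 0"
proof -
  have mat_vec: "mat z *v v = z *s v" for v :: "complex ^ 'a"
    by (simp add: vec_eq_iff matrix_vector_mult_def mat_def if_distrib if_distribR cong: if_cong)
  have "poly (charpoly (complex_mat A)) z = 0 \<longleftrightarrow> \<not> invertible (mat z - complex_mat A)"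
    by (simp add: poly_charpoly invertible_det_nz)
  also have "\<dots> \<longleftrightarrow> (\<exists>v. v \<noteq> 0 \<and> (mat z - complex_mat A) *v v = 0)"
    by (auto simp: invertible_left_inverse matrix_left_invertible_ker)
  also have "\<dots> \<longleftrightarrow> z \<in> eigenvalues A"
    by (auto simp: eigenvalues_def matrix_vector_mult_diff_rdistrib mat_vec)
  finally show ?thesis by simp
qed

lemma eigenvalue_intro:
  assumes "complex_mat A *v v = z *s v" and "v \<noteq> 0"
  shows "z \<in> eigenvalues A"
  using assms by (auto simp: eigenvalues_def)

text \<open>The characteristic polynomial is not zero because eigenvalues are bounded by the operator norm.\<close>

lemma finite_eigenvalues: "finite (eigenvalues A)"
proof -
  let ?C = "complex_mat A"
  let ?K = "onorm ((*v) ?C)"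
  define z where "z = complex_of_real (?K + 1)"
  have K: "0 \<le> ?K" by (rule onorm_pos_le) simp
  have "z \<notin> eigenvalues A"
  proof
    assume "z \<in> eigenvalues A"
    then obtain v where v: "v \<noteq> 0" "?C *v v = z *s v" by (auto simp: eigenvalues_def)
    \<comment> \<open>Since \<open>z\<close> is real, the complex scaling is a real one, whose
      effect on the norm is known.\<close>
    have "z *s v = (?K + 1) *\<^sub>R v"
      by (simp add: z_def vec_eq_iff) (simp add: scaleR_conv_of_real algebra_simps)
    then have "(?K + 1) * norm v = norm (?C *v v)" using v K by simp
    also have "\<dots> \<le> ?K * norm v" by (rule onorm) simp
    finally show False using v(1) by (simp add: algebra_simps)
  qed
  then have "charpoly ?C \<noteq> 0" by (auto simp: eigenvalue_iff_charpoly_root)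
  then show ?thesis
    using poly_roots_finite[of "charpoly ?C"] by (simp flip: eigenvalue_iff_charpoly_root)
qed

text \<open>\<open>Max\<close> is an upper bound only over a finite set, hence the detour through
  the characteristic polynomial. A zero abscissa now yields the half-plane condition
  \<open>Re z \<le> 0\<close> used below.\<close>

lemma Re_eigenvalue_le_spectral_abscissa:
  "z \<in> eigenvalues A \<Longrightarrow> Re z \<le> spectral_abscissa A"
  unfolding spectral_abscissa_def by (intro Max_ge) (simp_all add: finite_eigenvalues)

section \<open>Trivial kernels of the denominators\<close>

text \<open>Real kernel vectors must be embedded in the complex space, because
  \<open>eigenvalues\<close> refers to complex eigenvectors.\<close>

definition complex_vec :: "real ^ 'n \<Rightarrow> complex ^ 'n" where
  "complex_vec v = (\<chi> i. complex_of_real (v $ i))"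

lemma complex_vec_nth [simp]: "complex_vec v $ i = complex_of_real (v $ i)"
  by (simp add: complex_vec_def)

lemma complex_vec_eq_0_iff [simp]: "complex_vec v = 0 \<longleftrightarrow> v = 0"
  by (simp add: vec_eq_iff)

lemma complex_mat_vec: "complex_mat A *v complex_vec v = complex_vec (A *v v)"
  by (simp add: vec_eq_iff matrix_vector_mult_def complex_mat_def)

text \<open>
  For a kernel vector \<open>v\<close> the factorization
  $1 - z + z^2/2 = \frac12 (z - (1 + i))(z - (1 - i))$ turns \<open>v\<close>, or its image \<open>w\<close> under the
  second factor, into an eigenvector with eigenvalue in the open right half plane.
\<close>

lemma pade_denominator_trivial_kernel:
  fixes A :: "real ^ 'n ^ 'n"
  assumes spec: "\<forall>z\<in>eigenvalues A. Re z \<le> 0" and s: "0 < s"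
    and ker: "(mat 1 - s *\<^sub>R A + (s\<^sup>2 / 2) *\<^sub>R (A ** A)) *v v = 0"
  shows "v = 0"
proof (rule ccontr)
  assume v: "v \<noteq> 0"
  define a b where "a = (1 + \<i>) / complex_of_real s" and "b = (1 - \<i>) / complex_of_real s"
  have re: "Re a > 0" "Re b > 0" using s by (simp_all add: a_def b_def)
  define u q where "u = A *v v" and "q = A *v u"
  define w where "w = complex_vec u - b *s complex_vec v"
  have "v - s *\<^sub>R u + (s\<^sup>2 / 2) *\<^sub>R q = 0"
    using ker by (simp add: u_def q_def matrix_vector_mult_add_rdistrib
        matrix_vector_mult_diff_rdistrib scaleR_matrix_vector_assoc[symmetric]
        matrix_vector_mul_assoc[symmetric])
  then have q: "v $ i - s * u $ i + s\<^sup>2 / 2 * q $ i = 0" for i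
    by (auto simp: vec_eq_iff)
  \<comment> \<open>The numbers \<open>a\<close> and \<open>b\<close> are the roots of
    \<open>1 - s * z + s\<^sup>2 / 2 * z\<^sup>2\<close>, so by these two relations the kernel
    equation says that \<open>(A - a) (A - b)\<close> annihilates \<open>v\<close>.\<close>
  have ab: "a + b = 2 / complex_of_real s" "a * b = 2 / (complex_of_real s)\<^sup>2"
    using s by (simp_all add: a_def b_def field_simps power2_eq_square)
  show False
  proof (cases "w = 0")
    case True
    then have "complex_vec u = b *s complex_vec v" by (simp add: w_def)
    then have "complex_mat A *v complex_vec v = b *s complex_vec v"
      unfolding complex_mat_vec u_def .
    then have "b \<in> eigenvalues A" by (rule eigenvalue_intro) (simp add: v)
    then show False using spec re by fastforce
  next
    case False
    have "complex_mat A *v w = complex_vec q - b *s complex_vec u"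
      by (simp add: w_def u_def q_def matrix_vector_mult_diff_distrib complex_mat_vec
          vector_scalar_commute)
    also have "\<dots> = a *s w"
    proof (subst vec_eq_iff, intro allI)
      fix i
      have "q $ i = 2 / s * u $ i - 2 / s\<^sup>2 * v $ i"
        using q[of i] s by (simp add: field_simps power2_eq_square)
      then have "complex_of_real (q $ i) = (a + b) * u $ i - a * b * v $ i"
        unfolding ab by simp
      then show "(complex_vec q - b *s complex_vec u) $ i = (a *s w) $ i"
        by (simp add: w_def algebra_simps)
    qed
    finally have "a \<in> eigenvalues A" using False by (rule eigenvalue_intro)
    then show False using spec re by fastforce
  qed
qed

text \<open>A nonzero kernel vector would be an eigenvector for the positive eigenvalue
  \<open>2 / s\<close>.\<close>

lemma cayley_denominator_trivial_kernel:
  fixes A :: "real ^ 'n ^ 'n"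
  assumes spec: "\<forall>z\<in>eigenvalues A. Re z \<le> 0" and s: "0 < s"
    and ker: "(mat 1 - (s / 2) *\<^sub>R A) *v v = 0"
  shows "v = 0"
proof (rule ccontr)
  assume v: "v \<noteq> 0"
  have "v = (s / 2) *\<^sub>R (A *v v)"
    using ker by (simp add: matrix_vector_mult_diff_rdistrib scaleR_matrix_vector_assoc[symmetric])
  then have "(2 / s) *\<^sub>R v = (2 / s) *\<^sub>R (s / 2) *\<^sub>R (A *v v)" by metis
  then have "A *v v = (2 / s) *\<^sub>R v" using s by simp
  then have "complex_mat A *v complex_vec v = complex_of_real (2 / s) *s complex_vec v"
    by (simp add: complex_mat_vec vec_eq_iff)
  then have "complex_of_real (2 / s) \<in> eigenvalues A"
    by (rule eigenvalue_intro) (simp add: v)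
  then have "2 / s \<le> 0" using spec by fastforce
  then show False using s by (simp add: field_simps)
qed

section \<open>Kronecker products\<close>

text \<open>This is the mixed-product property: the sum over index pairs splits into a product of
  two sums.\<close>

lemma kronecker_mult:
  "(A \<otimes>\<^sub>K B) ** (C \<otimes>\<^sub>K D) = (A ** C) \<otimes>\<^sub>K (B ** D)"
proof -
  have "(\<Sum>k\<in>UNIV. A $ fst r $ fst k * B $ snd r $ snd k * (C $ fst k $ fst c * D $ snd k $ snd c))
      = (\<Sum>i\<in>UNIV. A $ fst r $ i * C $ i $ fst c) * (\<Sum>j\<in>UNIV. B $ snd r $ j * D $ j $ snd c)" for r c
    by (simp add: sum_product sum.cartesian_product case_prod_unfold mult_ac)
  then show ?thesis
    by (simp add: vec_eq_iff kronecker_def matrix_matrix_mult_def)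
qed

lemma kronecker_mat_1: "mat 1 \<otimes>\<^sub>K mat 1 = mat 1"
  by (auto simp: vec_eq_iff kronecker_def mat_def prod_eq_iff)

lemma kronecker_nonneg: "0 \<le> A \<Longrightarrow> 0 \<le> B \<Longrightarrow> 0 \<le> A \<otimes>\<^sub>K B"
  by (simp add: nonneg_matrix_iff kronecker_def)

lemma mat_1_nonneg: "0 \<le> (mat 1 :: real ^ 'n ^ 'n)"
  by (simp add: nonneg_matrix_iff mat_def)

lemma col_sum_kronecker: "col_sum (A \<otimes>\<^sub>K B) j = col_sum A (fst j) * col_sum B (snd j)"
  by (simp add: col_sum_def kronecker_def sum_product sum.cartesian_product case_prod_unfold)

section \<open>The Pade and central factors\<close>

lemma pade_factor_inverse:
  assumes "\<forall>z\<in>eigenvalues A. Re z \<le> 0" and "0 < s"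
  shows "(mat 1 - s *\<^sub>R A + (s\<^sup>2 / 2) *\<^sub>R (A ** A)) ** pade_factor A s = mat 1"
  unfolding pade_factor_def
  using pade_denominator_trivial_kernel[OF assms] by (rule matrix_inv_right_of_trivial_kernel)

lemma col_sum_pade_factor:
  assumes "\<forall>z\<in>eigenvalues A. Re z \<le> 0" and "0 < s" and "\<forall>j. col_sum A j = 0"
  shows "\<forall>j. col_sum (pade_factor A s) j = 1"
  by (rule col_sum_right_inverse[OF _ pade_factor_inverse[OF assms(1,2)]])
    (simp add: assms(3) col_sum_add col_sum_diff col_sum_scaleR col_sum_mat_1 col_sum_matrix_mult)

text \<open>The denominator is itself a Kronecker product with the identity, so it is inverted in
  its first component alone. Only the spectrum of \<open>L\<close> enters, not that of
  \<open>A_x L\<close>.\<close>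

lemma pade_factor_A_x:
  fixes L :: "real ^ 'nx ^ 'nx"
  assumes "\<forall>z\<in>eigenvalues L. Re z \<le> 0" and "0 < s"
  shows "pade_factor (A_x L :: real ^ ('nx::finite \<times> 'ny::finite) ^ ('nx \<times> 'ny)) s = pade_factor L s \<otimes>\<^sub>K mat 1"
proof -
  let ?M = "mat 1 - s *\<^sub>R L + (s\<^sup>2 / 2) *\<^sub>R (L ** L)"
  let ?A = "A_x L :: real ^ ('nx \<times> 'ny) ^ ('nx \<times> 'ny)"
  \<comment> \<open>Writing the identity as \<open>mat 1 \<otimes>\<^sub>K mat 1\<close> gives all
    three summands the same right factor.\<close>
  have "mat 1 - s *\<^sub>R ?A + (s\<^sup>2 / 2) *\<^sub>R (?A ** ?A) = ?M \<otimes>\<^sub>K mat 1"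
    unfolding A_x_def kronecker_mult matrix_mul_lid kronecker_mat_1[symmetric]
    by (simp add: vec_eq_iff kronecker_def algebra_simps)
  then show ?thesis
    unfolding pade_factor_def[of ?A]
    by (simp add: matrix_inv_unique kronecker_mult pade_factor_inverse[OF assms] kronecker_mat_1)
qed

lemma pade_factor_A_y:
  fixes L :: "real ^ 'ny ^ 'ny"
  assumes "\<forall>z\<in>eigenvalues L. Re z \<le> 0" and "0 < s"
  shows "pade_factor (A_y L :: real ^ ('nx::finite \<times> 'ny::finite) ^ ('nx \<times> 'ny)) s = mat 1 \<otimes>\<^sub>K pade_factor L s"
proof -
  let ?M = "mat 1 - s *\<^sub>R L + (s\<^sup>2 / 2) *\<^sub>R (L ** L)"
  let ?A = "A_y L :: real ^ ('nx \<times> 'ny) ^ ('nx \<times> 'ny)"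
  have "mat 1 - s *\<^sub>R ?A + (s\<^sup>2 / 2) *\<^sub>R (?A ** ?A) = mat 1 \<otimes>\<^sub>K ?M"
    unfolding A_y_def kronecker_mult matrix_mul_lid kronecker_mat_1[symmetric]
    by (simp add: vec_eq_iff kronecker_def algebra_simps)
  then show ?thesis
    unfolding pade_factor_def[of ?A]
    by (simp add: matrix_inv_unique kronecker_mult pade_factor_inverse[OF assms] kronecker_mat_1)
qed

lemma col_sum_central_factor:
  assumes "\<forall>z\<in>eigenvalues A. Re z \<le> 0" and "0 < s" and "\<forall>j. col_sum A j = 0"
  shows "\<forall>j. col_sum (central_factor A s) j = 1"
  unfolding central_factor_def
proof (rule col_sum_matrix_mult_unit)
  have "(mat 1 - (s / 2) *\<^sub>R A) ** matrix_inv (mat 1 - (s / 2) *\<^sub>R A) = mat 1"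
    using cayley_denominator_trivial_kernel[OF assms(1,2)] by (rule matrix_inv_right_of_trivial_kernel)
  then show "\<forall>j. col_sum (matrix_inv (mat 1 - (s / 2) *\<^sub>R A)) j = 1"
    by (rule col_sum_right_inverse[rotated])
      (simp add: assms(3) col_sum_diff col_sum_scaleR col_sum_mat_1)
qed (simp add: assms(3) col_sum_add col_sum_scaleR col_sum_mat_1)

text \<open>Strict positivity is relaxed here because tensoring with an identity matrix can create
  zero entries.\<close>

lemma pade_factor_nonneg:
  assumes "pade_threshold L \<gamma>r" and "0 < s" and "\<gamma>r \<le> s"
  shows "0 \<le> pade_factor L s"
  using assms by (auto simp: pade_threshold_def entrywise_pos_def nonneg_matrix_iff intro: less_imp_le)

theorem proposition3:
  fixes Lx :: "real ^ 'nx ^ 'nx"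
    and Ly :: "real ^ 'ny ^ 'ny"
    and Axy :: "real ^ ('nx::finite \<times> 'ny::finite) ^ ('nx \<times> 'ny)"
    and \<gamma>x \<gamma>y \<Theta> dt :: real
  assumes "irreducible_mat Lx" and "\<forall>j. col_sum Lx j = 0"
    and "spectral_abscissa Lx = 0" and "simple_eigenvalue Lx 0" and "eventually_exp_pos Lx"
    and "irreducible_mat Ly" and "\<forall>j. col_sum Ly j = 0"
    and "spectral_abscissa Ly = 0" and "simple_eigenvalue Ly 0" and "eventually_exp_pos Ly"
    and "\<forall>j. col_sum Axy j = 0"
    and "\<forall>z\<in>eigenvalues Axy. Im z = 0 \<and> Re z \<le> 0"
    and "pade_threshold Lx \<gamma>x" and "pade_threshold Ly \<gamma>y"
    and "central_window Axy \<Theta>"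
    and "dt > 0" and "dt / 2 \<ge> \<gamma>x" and "dt / 2 \<ge> \<gamma>y" and "dt \<le> \<Theta>"
  shows "0 \<le> pade_factor (A_x Lx :: real ^ ('nx \<times> 'ny) ^ ('nx \<times> 'ny)) (dt / 2)
    \<and> 0 \<le> pade_factor (A_y Ly :: real ^ ('nx \<times> 'ny) ^ ('nx \<times> 'ny)) (dt / 2)
    \<and> 0 \<le> central_factor Axy dt
    \<and> column_stochastic (S_ADI Lx Ly Axy dt)
    \<and> (\<forall>p\<ge>0. 0 \<le> S_ADI Lx Ly Axy dt *v p)
    \<and> (\<forall>p\<ge>0. l1_norm (S_ADI Lx Ly Axy dt *v p) \<le> l1_norm p)"
proof -
  have sx: "\<forall>z\<in>eigenvalues Lx. Re z \<le> 0" and sy: "\<forall>z\<in>eigenvalues Ly. Re z \<le> 0"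
    using Re_eigenvalue_le_spectral_abscissa assms(3,8) by metis+
  have s: "0 < dt / 2" using assms(16) by simp
  let ?X = "pade_factor (A_x Lx :: real ^ ('nx \<times> 'ny) ^ ('nx \<times> 'ny)) (dt / 2)"
  let ?Y = "pade_factor (A_y Ly :: real ^ ('nx \<times> 'ny) ^ ('nx \<times> 'ny)) (dt / 2)"
  let ?Z = "central_factor Axy dt"
  let ?S = "S_ADI Lx Ly Axy dt"
  \<comment> \<open>The threshold concerns \<open>Lx\<close>, so the factor is first rewritten as a
    Kronecker product; its column sums are then products of unit column sums.\<close>
  have X: "0 \<le> ?X" "\<forall>j. col_sum ?X j = 1"
    unfolding pade_factor_A_x[OF sx s]
    using pade_factor_nonneg[OF assms(13) s assms(17)] col_sum_pade_factor[OF sx s assms(2)]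
    by (simp_all add: kronecker_nonneg mat_1_nonneg col_sum_kronecker col_sum_mat_1)
  have Y: "0 \<le> ?Y" "\<forall>j. col_sum ?Y j = 1"
    unfolding pade_factor_A_y[OF sy s]
    using pade_factor_nonneg[OF assms(14) s assms(18)] col_sum_pade_factor[OF sy s assms(7)]
    by (simp_all add: kronecker_nonneg mat_1_nonneg col_sum_kronecker col_sum_mat_1)
  have Z: "0 \<le> ?Z" "\<forall>j. col_sum ?Z j = 1"
    using assms(15,16,19) col_sum_central_factor[of Axy dt] assms(11,12)
    by (auto simp: central_window_def)
  have S: "column_stochastic ?S"
    unfolding column_stochastic_def S_ADI_def
    by (intro conjI nonneg_matrix_mult col_sum_matrix_mult_unit X Y Z)
  then have "\<forall>p\<ge>0. 0 \<le> ?S *v p" and "\<forall>p\<ge>0. l1_norm (?S *v p) \<le> l1_norm p"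
    by (simp_all add: column_stochastic_def nonneg_matrix_vector_mult column_stochastic_l1_norm)
  with X(1) Y(1) Z(1) S show ?thesis by blast
qed

end
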